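(* Let $n\ge 2$, let $\alpha=(\alpha_1,\ldots,\alpha_n)$ with all $\alpha_i>0$, and let $X=(X_1,\ldots,X_n)\sim\mathrm{Dir}(\alpha)$. Then the random vector of log-ratios $$Y=\left(\log\frac{X_1}{X_n},\ldots,\log\frac{X_{n-1}}{X_n}\right)$$ has, with respect to Lebesgue measure on $\mathbb{R}^{n-1}$, the probability density $$f_Y(y)=\frac{1}{B(\alpha)}\left(\prod_{i=1}^{n-1}(e^{y_i})^{\alpha_i}\right)\left(1+\sum_{i=1}^{n-1}e^{y_i}\right)^{-\sum_{i=1}^{n}\alpha_i},\qquad y=(y_1,\ldots,y_{n-1})\in\mathbb{R}^{n-1}.$$
   Context: For $\alpha=(\alpha_1,\ldots,\alpha_n)$ with positive entries, $B(\alpha)=\frac{\prod_{i=1}^{n}\Gamma(\alpha_i)}{\Gamma(\sum_{i=1}^{n}\alpha_i)}$. The Dirichlet distribution $\mathrm{Dir}(\alpha)$ is the distribution of a random vector $X=(X_1,\ldots,X_n)$ with all components in $(0,1)$ and $\sum_{i=1}^n X_i=1$, such that $(X_1,\ldots,X_{n-1})$ has density $\frac{1}{B(\alpha)}\prod_{i=1}^{n}x_i^{\alpha_i-1}$, where $x_n=1-\sum_{i=1}^{n-1}x_i$, with respect to Lebesgue measure on $\{(x_1,\ldots,x_{n-1}): x_i>0,\ \sum_{i=1}^{n-1}x_i<1\}$. Here $\log$ is the natural logarithm. *)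

theory Defs
  imports "HOL-Probability.Probability"
begin

definition multi_beta :: "nat \<Rightarrow> (nat \<Rightarrow> real) \<Rightarrow> real" where
  "multi_beta n \<alpha> = (\<Prod>i=1..n. Gamma (\<alpha> i)) / Gamma (\<Sum>i=1..n. \<alpha> i)"

(* A point of R^(n-1) is an extensional function on {1..<n}, and Lebesgue measure on
   R^(n-1) is the (n-1)-fold product of one-dimensional Lebesgue measure. *)
abbreviation lborel_prod :: "nat \<Rightarrow> (nat \<Rightarrow> real) measure" where
  "lborel_prod n \<equiv> (\<Pi>\<^sub>M i\<in>{1..<n}. (lborel :: real measure))"

(* The density of the first n - 1 components, extended by 0 off the open simplex. *)
definition dirichlet_density :: "nat \<Rightarrow> (nat \<Rightarrow> real) \<Rightarrow> (nat \<Rightarrow> real) \<Rightarrow> real" where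
  "dirichlet_density n \<alpha> x =
     (if (\<forall>i\<in>{1..<n}. 0 < x i) \<and> (\<Sum>i\<in>{1..<n}. x i) < 1
      then 1 / multi_beta n \<alpha> *
        (\<Prod>i=1..n. (x(n := 1 - (\<Sum>j\<in>{1..<n}. x j))) i powr (\<alpha> i - 1))
      else 0)"

(* X ~ Dir(alpha). This is a property of the law of X only, so the constraints on the
   values of X are required almost surely. *)
definition dirichlet_distributed ::
  "'a measure \<Rightarrow> nat \<Rightarrow> (nat \<Rightarrow> real) \<Rightarrow> (nat \<Rightarrow> 'a \<Rightarrow> real) \<Rightarrow> bool" where
  "dirichlet_distributed M n \<alpha> X \<longleftrightarrow>
     (\<forall>i\<in>{1..n}. X i \<in> borel_measurable M) \<and>
     (AE \<omega> in M. (\<forall>i\<in>{1..n}. X i \<omega> \<in> {0<..<1}) \<and> (\<Sum>i=1..n. X i \<omega>) = 1) \<and>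
     distributed M (lborel_prod n) (\<lambda>\<omega>. \<lambda>i\<in>{1..<n}. X i \<omega>)
       (\<lambda>x. ennreal (dirichlet_density n \<alpha> x))"

end

(* Instead of computing a Jacobian determinant, evaluate the integral of
   t^(-m) G(w/t) over the region 0 < w_i, sum w < t < 1 in R^m x R in two ways, by Fubini.
   Scaling w = t x for fixed t gives the integral of G over the open simplex.
   Translating t = sum w + r for fixed w and then substituting w_i = r exp(y_i) for fixed r
   gives w/t = exp(y) / (1 + sum exp(y)), and integrating out r, which ranges over
   0 < r < 1 / (1 + sum exp(y)), yields the integral in log-ratio coordinates. *)
theory Submission
  imports Defs
begin

section \<open>Changes of variables in one coordinate, then coordinate by coordinate\<close>

text \<open>On compact intervals this is the classical substitution rule. The images of [-k, k]
  under \<open>exp\<close> exhaust the positive half-line, so monotone convergence on both sides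
  gives the full statement.\<close>

lemma nn_integral_exp_substitution:
  fixes h :: "real \<Rightarrow> ennreal"
  assumes h [measurable]: "h \<in> borel_measurable borel"
  shows "(\<integral>\<^sup>+u. h u * indicator {0<..} u \<partial>lborel) = (\<integral>\<^sup>+y. h (exp y) * ennreal (exp y) \<partial>lborel)"
proof -
  have l: "(SUP k::nat. h u * indicator {exp (- real k)..exp (real k)} u) = h u * indicator {0<..} u" for u
  proof (cases "u > 0")
    case True
    obtain k :: nat where k: "\<bar>ln u\<bar> \<le> real k" using real_arch_simple by blast
    have "ln u \<le> real k" "- real k \<le> ln u" using k by auto
    then have "u \<in> {exp (- real k)..exp (real k)}"
      using True by (metis atLeastAtMost_iff exp_le_cancel_iff exp_ln)
    then have "h u * indicator {0<..} u \<le> (SUP k::nat. h u * indicator {exp (- real k)..exp (real k)} u)"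
      using True by (intro SUP_upper2[of k]) auto
    moreover have "(SUP k::nat. h u * indicator {exp (- real k)..exp (real k)} u) \<le> h u * indicator {0<..} u"
      using True by (intro SUP_least) (auto split: split_indicator)
    ultimately show ?thesis by (rule antisym[rotated])
  next
    case False
    then have "u \<notin> {exp (- real k)..exp (real k)}" for k
      using exp_gt_zero[of "- real k"] by (auto simp del: exp_gt_zero)
    with False show ?thesis by simp
  qed
  have r: "(SUP k::nat. h (exp y) * ennreal (exp y) * indicator {- real k..real k} y) = h (exp y) * ennreal (exp y)" for y
  proof -
    obtain k :: nat where k: "\<bar>y\<bar> \<le> real k" using real_arch_simple by blast
    then have "h (exp y) * ennreal (exp y) \<le> (SUP k::nat. h (exp y) * ennreal (exp y) * indicator {- real k..real k} y)"
      by (intro SUP_upper2[of k]) (auto simp: indicator_def abs_le_iff)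
    moreover have "(SUP k::nat. h (exp y) * ennreal (exp y) * indicator {- real k..real k} y) \<le> h (exp y) * ennreal (exp y)"
      by (intro SUP_least) (auto split: split_indicator)
    ultimately show ?thesis by (rule antisym[rotated])
  qed
  have s: "(\<integral>\<^sup>+u. h u * indicator {exp (- real k)..exp (real k)} u \<partial>lborel)
      = (\<integral>\<^sup>+y. h (exp y) * ennreal (exp y) * indicator {- real k..real k} y \<partial>lborel)" for k :: nat
  \<comment> \<open>The interval rule wants a nondegenerate interval. For k = 0 both intervals are
    single points, hence null sets, and both integrals vanish.\<close>
  proof (cases "k = 0")
    case True
    have z: "AE u in lborel. u \<noteq> (c::real)" for c by (rule AE_lborel_singleton)
    have "(\<integral>\<^sup>+u. h u * indicator {1..1} u \<partial>lborel) = (\<integral>\<^sup>+(u::real). 0 \<partial>lborel)"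
      by (rule nn_integral_cong_AE, use z[of 1] in eventually_elim) (auto split: split_indicator)
    moreover have "(\<integral>\<^sup>+y. h (exp y) * ennreal (exp y) * indicator {0..0} y \<partial>lborel) = (\<integral>\<^sup>+(u::real). 0 \<partial>lborel)"
      by (rule nn_integral_cong_AE, use z[of 0] in eventually_elim) (auto split: split_indicator)
    ultimately show ?thesis using True by simp
  next
    case False
    then show ?thesis
      by (intro nn_integral_substitution_aux) (auto intro!: derivative_eq_intros continuous_intros)
  qed
  have mono: "{exp (- real m)..exp (real m)} \<subseteq> {exp (- real n)..exp (real n)}" if "m \<le> n" for m n :: nat
    using that by simp
  have "(\<integral>\<^sup>+u. h u * indicator {0<..} u \<partial>lborel)
      = (SUP k::nat. \<integral>\<^sup>+u. h u * indicator {exp (- real k)..exp (real k)} u \<partial>lborel)"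
    unfolding l[symmetric]
    by (rule nn_integral_monotone_convergence_SUP)
       (auto simp: incseq_def le_fun_def simp del: atLeastAtMost_iff
          split: split_indicator dest: subsetD[OF mono])
  also have "\<dots> = (\<integral>\<^sup>+y. h (exp y) * ennreal (exp y) \<partial>lborel)"
    unfolding s
    by (subst nn_integral_monotone_convergence_SUP[symmetric])
       (auto simp: r incseq_def le_fun_def split: split_indicator)
  finally show ?thesis .
qed

text \<open>Serves both the scaling and the exponential substitution below, with \<open>v\<close>
  the indicator of the positive half-line and \<open>w\<close> the factor contributed by the
  derivative. Only the weights have to be products; \<open>F\<close> may couple the coordinates.
  Splitting off one coordinate gives an iterated integral: the induction hypothesis treats the inner
  one and \<open>sub\<close> the outer one.\<close>

lemma nn_integral_PiM_coordinatewise: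
  fixes N :: "'b measure" and I :: "'i set" and F :: "('i \<Rightarrow> 'b) \<Rightarrow> ennreal"
  assumes "sigma_finite_measure N" and "finite I"
    and [measurable]: "\<phi> \<in> measurable N N" "v \<in> borel_measurable N" "w \<in> borel_measurable N"
    and sub: "\<And>h. h \<in> borel_measurable N \<Longrightarrow> (\<integral>\<^sup>+x. h x * v x \<partial>N) = (\<integral>\<^sup>+x. h (\<phi> x) * w x \<partial>N)"
    and F: "F \<in> borel_measurable (PiM I (\<lambda>_. N))"
  shows "(\<integral>\<^sup>+x. F x * (\<Prod>i\<in>I. v (x i)) \<partial>PiM I (\<lambda>_. N))
       = (\<integral>\<^sup>+x. F (\<lambda>i\<in>I. \<phi> (x i)) * (\<Prod>i\<in>I. w (x i)) \<partial>PiM I (\<lambda>_. N))"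
  using \<open>finite I\<close> F
proof (induction I arbitrary: F)
  case empty
  then show ?case by (simp add: PiM_empty nn_integral_count_space_finite)
next
  case (insert i I)
  interpret sigma_finite_measure N by fact
  interpret product_sigma_finite "\<lambda>_::'i. N" by standard
  interpret I: finite_product_sigma_finite "\<lambda>_::'i. N" I by standard (fact insert)
  note [measurable] = insert.prems
  have ne: "j \<in> I \<Longrightarrow> j \<noteq> i" for j using insert by auto
  have "(\<integral>\<^sup>+x. F x * (\<Prod>i\<in>insert i I. v (x i)) \<partial>PiM (insert i I) (\<lambda>_. N))
      = (\<integral>\<^sup>+y. (\<integral>\<^sup>+x. F (x(i := y)) * (\<Prod>j\<in>insert i I. v ((x(i := y)) j)) \<partial>PiM I (\<lambda>_. N)) \<partial>N)"
    by (rule product_nn_integral_insert_rev) (use insert in measurable)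
  \<comment> \<open>The update at \<open>i\<close> leaves the coordinates in \<open>I\<close> alone,
    so the factor \<open>v y\<close> is constant in the inner integral and can be pulled
    out.\<close>
  also have "\<dots> = (\<integral>\<^sup>+y. (\<integral>\<^sup>+x. F (x(i := y)) * (\<Prod>j\<in>I. v (x j)) \<partial>PiM I (\<lambda>_. N)) * v y \<partial>N)"
  proof (rule nn_integral_cong)
    fix y assume [measurable]: "y \<in> space N"
    show "(\<integral>\<^sup>+x. F (x(i := y)) * (\<Prod>j\<in>insert i I. v ((x(i := y)) j)) \<partial>PiM I (\<lambda>_. N))
      = (\<integral>\<^sup>+x. F (x(i := y)) * (\<Prod>j\<in>I. v (x j)) \<partial>PiM I (\<lambda>_. N)) * v y"
      by (subst nn_integral_multc[symmetric], measurable)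
         (use insert(1,2) ne in \<open>simp add: mult_ac cong: prod.cong_simp\<close>)
  qed
  \<comment> \<open>For fixed \<open>y\<close> the induction hypothesis is applied to the section of
    \<open>F\<close> at \<open>y\<close>; hence the induction with \<open>F\<close>
    arbitrary.\<close>
  also have "\<dots> = (\<integral>\<^sup>+y. (\<integral>\<^sup>+x. F ((\<lambda>j\<in>I. \<phi> (x j))(i := y)) * (\<Prod>j\<in>I. w (x j)) \<partial>PiM I (\<lambda>_. N)) * v y \<partial>N)"
    by (intro nn_integral_cong arg_cong2[where f="(*)"] insert.IH refl) measurable
  \<comment> \<open>Here \<open>h\<close> is the whole inner integral, as a function of
    \<open>y\<close>.\<close>
  also have "\<dots> = (\<integral>\<^sup>+y. (\<integral>\<^sup>+x. F ((\<lambda>j\<in>I. \<phi> (x j))(i := \<phi> y)) * (\<Prod>j\<in>I. w (x j)) \<partial>PiM I (\<lambda>_. N)) * w y \<partial>N)"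
    by (rule sub) measurable
  also have "\<dots> = (\<integral>\<^sup>+y. (\<integral>\<^sup>+x. F (\<lambda>j\<in>insert i I. \<phi> ((x(i := y)) j)) * (\<Prod>j\<in>insert i I. w ((x(i := y)) j)) \<partial>PiM I (\<lambda>_. N)) \<partial>N)"
  proof (rule nn_integral_cong)
    fix y assume [measurable]: "y \<in> space N"
    have e: "(\<lambda>j\<in>insert i I. \<phi> ((x(i := y)) j)) = (\<lambda>j\<in>I. \<phi> (x j))(i := \<phi> y)" for x
      by (auto simp: fun_eq_iff)
    show "(\<integral>\<^sup>+x. F ((\<lambda>j\<in>I. \<phi> (x j))(i := \<phi> y)) * (\<Prod>j\<in>I. w (x j)) \<partial>PiM I (\<lambda>_. N)) * w y
      = (\<integral>\<^sup>+x. F (\<lambda>j\<in>insert i I. \<phi> ((x(i := y)) j)) * (\<Prod>j\<in>insert i I. w ((x(i := y)) j)) \<partial>PiM I (\<lambda>_. N))"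
      unfolding e
      by (subst nn_integral_multc[symmetric], measurable)
         (use insert(1,2) ne in \<open>simp add: mult_ac cong: prod.cong_simp\<close>)
  qed
  also have "\<dots> = (\<integral>\<^sup>+x. F (\<lambda>j\<in>insert i I. \<phi> (x j)) * (\<Prod>j\<in>insert i I. w (x j)) \<partial>PiM (insert i I) (\<lambda>_. N))"
    by (rule product_nn_integral_insert_rev[symmetric]) (use insert in measurable)
  finally show ?case .
qed


section \<open>From the open simplex to log-ratio coordinates\<close>

text \<open>The weight on the right is the Jacobian determinant of the inverse log-ratio map. Its
  exponent \<open>Suc (card I)\<close> has two sources: \<open>card I\<close> from the factor t^(-m)
  with m = \<open>card I\<close>, and one more from the length of the interval over which r is
  integrated.\<close>

lemma nn_integral_log_ratio_substitution:
  fixes I :: "'i set" and G :: "('i \<Rightarrow> real) \<Rightarrow> ennreal"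
  defines "P \<equiv> PiM I (\<lambda>_. lborel :: real measure)"
  assumes fin: "finite I" and G [measurable]: "G \<in> borel_measurable P"
  shows "(\<integral>\<^sup>+x. G x * indicator {..<1} (\<Sum>i\<in>I. x i) * (\<Prod>i\<in>I. indicator {0<..} (x i)) \<partial>P)
    = (\<integral>\<^sup>+y. G (\<lambda>i\<in>I. exp (y i) / (1 + (\<Sum>j\<in>I. exp (y j)))) *
        ennreal ((\<Prod>i\<in>I. exp (y i)) / (1 + (\<Sum>j\<in>I. exp (y j))) ^ Suc (card I)) \<partial>P)"
    (is "?L = ?R")
proof -
  interpret product_sigma_finite "\<lambda>_::'i. lborel :: real measure" by standard
  interpret I: finite_product_sigma_finite "\<lambda>_::'i. lborel :: real measure" I
    by standard (fact fin)
  interpret P: sigma_finite_measure P unfolding P_def by (rule I.sigma_finite_measure_axioms)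
  interpret LP: pair_sigma_finite "lborel :: real measure" P ..
  \<comment> \<open>The factor \<open>t ^ - card I\<close> on \<open>0 < t < 1\<close> makes the scaling \<open>w = t x\<close> volume preserving
    and the total mass in \<open>t\<close> equal to 1.\<close>
  define K :: "real \<Rightarrow> ('i \<Rightarrow> real) \<Rightarrow> ennreal" where
    "K t w = G (\<lambda>i\<in>I. w i / t) *
       (if (\<Sum>i\<in>I. w i) < t then 1 else 0) * indicator {0<..<1} t * ennreal ((1 / t) ^ card I)" for t w
  define pos :: "('i \<Rightarrow> real) \<Rightarrow> ennreal" where "pos w = (\<Prod>i\<in>I. indicator {0<..} (w i))" for w
  have comp [measurable]: "i \<in> I \<Longrightarrow> (\<lambda>w. w i) \<in> borel_measurable P" for i
    unfolding P_def by simp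
  have res: "(\<lambda>z. \<lambda>i\<in>I. f z i) \<in> measurable N P"
    if "\<And>i. i \<in> I \<Longrightarrow> (\<lambda>z. f z i) \<in> borel_measurable N" for f and N :: "'z measure"
    unfolding P_def using that by (intro measurable_restrict) simp
  have [measurable]: "pos \<in> borel_measurable P"
    unfolding pos_def by measurable
  \<comment> \<open>Stated for compositions because on the product space \<open>K\<close> is
    evaluated both at (t, w) and at (sum w + r, w).\<close>
  have [measurable]: "(\<lambda>z. K (f z) (g z)) \<in> borel_measurable N"
    if [measurable]: "f \<in> borel_measurable N" "g \<in> measurable N P" for f g and N :: "'z measure"
  proof -
    note [measurable] = that
    have [measurable]: "i \<in> I \<Longrightarrow> (\<lambda>z. g z i) \<in> borel_measurable N" for i
      using measurable_compose[OF that(2) comp] .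
    have [measurable]: "(\<lambda>z. \<lambda>i\<in>I. g z i / f z) \<in> measurable N P"
      by (rule res) measurable
    show ?thesis unfolding K_def by measurable
  qed

  have scaling: "(\<integral>\<^sup>+w. K t w * pos w \<partial>P) = ?L * indicator {0<..<1} t" for t
  proof (cases "0 < t \<and> t < 1")
    case True
    then have t: "0 < t" "t < 1" by auto
    have "(\<integral>\<^sup>+w. K t w * (\<Prod>i\<in>I. indicator {0<..} (w i)) \<partial>P)
        = (\<integral>\<^sup>+x. K t (\<lambda>i\<in>I. t * x i) * (\<Prod>i\<in>I. ennreal t * indicator {0<..} (x i)) \<partial>P)"
      unfolding P_def
    proof (rule nn_integral_PiM_coordinatewise)
      fix h :: "real \<Rightarrow> ennreal" assume [measurable]: "h \<in> borel_measurable lborel"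
      show "(\<integral>\<^sup>+x. h x * indicator {0<..} x \<partial>lborel)
          = (\<integral>\<^sup>+x. h (t * x) * (ennreal t * indicator {0<..} x) \<partial>lborel)"
        using t
        by (subst nn_integral_real_affine[where c=t and t=0])
           (auto simp: nn_integral_cmult[symmetric] zero_less_mult_iff mult_ac split: split_indicator
              intro!: nn_integral_cong)
    qed (use fin in \<open>simp_all flip: P_def, unfold_locales\<close>)
    also have "\<dots> = ?L"
    proof (rule nn_integral_cong)
      fix x assume "x \<in> space P"
      then have "(\<lambda>i\<in>I. t * x i / t) = x"
        using t by (auto simp: P_def space_PiM PiE_def extensional_def fun_eq_iff)
      moreover have "(\<Sum>i\<in>I. t * x i) < t \<longleftrightarrow> (\<Sum>i\<in>I. x i) < 1"
        using t by (simp add: sum_distrib_left[symmetric])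
      moreover have "ennreal ((1 / t) ^ card I) * ennreal t ^ card I = 1"
        using t by (simp add: ennreal_power ennreal_mult[symmetric] power_mult_distrib[symmetric] del: power_divide)
      ultimately show "K t (\<lambda>i\<in>I. t * x i) * (\<Prod>i\<in>I. ennreal t * indicator {0<..} (x i))
          = G x * indicator {..<1} (\<Sum>i\<in>I. x i) * (\<Prod>i\<in>I. indicator {0<..} (x i))"
        using t by (simp add: K_def prod.distrib indicator_def mult_ac cong: restrict_cong)
          (simp add: mult.assoc[symmetric])
    qed
    finally show ?thesis using t by (simp add: pos_def)
  qed (auto simp: K_def)

  \<comment> \<open>After t = sum w + r the condition sum w < t inside \<open>K\<close> reads 0 < r.
    The added indicator therefore changes nothing, but makes the positivity of r available to the
    next substitution.\<close>
  have translation: "(\<integral>\<^sup>+t. K t w * pos w \<partial>lborel)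
      = (\<integral>\<^sup>+r. K ((\<Sum>i\<in>I. w i) + r) w * pos w * indicator {0<..} r \<partial>lborel)"
    if [measurable]: "w \<in> space P" for w
  proof -
    have "(\<lambda>t. K t w * pos w) \<in> borel_measurable borel" by measurable
    from nn_integral_real_affine[OF this, of 1 "\<Sum>i\<in>I. w i"] show ?thesis
      by (auto simp: K_def intro!: nn_integral_cong split: split_indicator)
  qed

  have exponential: "(\<integral>\<^sup>+w. K ((\<Sum>i\<in>I. w i) + r) w * pos w \<partial>P)
      = (\<integral>\<^sup>+y. G (\<lambda>i\<in>I. exp (y i) / (1 + (\<Sum>j\<in>I. exp (y j)))) *
          ennreal ((\<Prod>i\<in>I. exp (y i)) / (1 + (\<Sum>j\<in>I. exp (y j))) ^ card I) *
          indicator {..<1 / (1 + (\<Sum>j\<in>I. exp (y j)))} r \<partial>P)" if r: "0 < r" for r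
  proof -
    have "(\<integral>\<^sup>+w. K ((\<Sum>i\<in>I. w i) + r) w * (\<Prod>i\<in>I. indicator {0<..} (w i)) \<partial>P)
        = (\<integral>\<^sup>+y. K ((\<Sum>i\<in>I. (\<lambda>i\<in>I. r * exp (y i)) i) + r) (\<lambda>i\<in>I. r * exp (y i)) *
             (\<Prod>i\<in>I. ennreal (r * exp (y i))) \<partial>P)"
      unfolding P_def
    proof (rule nn_integral_PiM_coordinatewise)
      fix h :: "real \<Rightarrow> ennreal" assume [measurable]: "h \<in> borel_measurable lborel"
      \<comment> \<open>In one coordinate: first dilate the half-line by \<open>r\<close>, then
        parametrize it by \<open>exp\<close>.\<close>
      have "(\<integral>\<^sup>+x. h x * indicator {0<..} x \<partial>lborel)
          = (\<integral>\<^sup>+x. (h (r * x) * ennreal r) * indicator {0<..} x \<partial>lborel)"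
        using r
        by (subst nn_integral_real_affine[where c=r and t=0])
           (auto simp: nn_integral_cmult[symmetric] zero_less_mult_iff mult_ac split: split_indicator
              intro!: nn_integral_cong)
      also have "\<dots> = (\<integral>\<^sup>+y. h (r * exp y) * ennreal r * ennreal (exp y) \<partial>lborel)"
        by (rule nn_integral_exp_substitution) measurable
      finally show "(\<integral>\<^sup>+x. h x * indicator {0<..} x \<partial>lborel)
          = (\<integral>\<^sup>+y. h (r * exp y) * ennreal (r * exp y) \<partial>lborel)"
        using r by (simp add: ennreal_mult mult_ac)
    qed (use fin in \<open>simp_all flip: P_def, unfold_locales\<close>)
    also have "\<dots> = (\<integral>\<^sup>+y. G (\<lambda>i\<in>I. exp (y i) / (1 + (\<Sum>j\<in>I. exp (y j)))) *
          ennreal ((\<Prod>i\<in>I. exp (y i)) / (1 + (\<Sum>j\<in>I. exp (y j))) ^ card I) *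
          indicator {..<1 / (1 + (\<Sum>j\<in>I. exp (y j)))} r \<partial>P)"
    proof (rule nn_integral_cong)
      fix y :: "'i \<Rightarrow> real"
      \<comment> \<open>With w = r exp(y), the scale t = sum w + r equals r S. Thus w/t = exp(y)/S
        is free of r, the powers of r cancel in \<open>jac\<close>, and the only trace of r is the
        constraint t < 1, that is r < 1/S.\<close>
      define S where "S = 1 + (\<Sum>j\<in>I. exp (y j))"
      have S: "S > 0" unfolding S_def by (simp add: add_pos_nonneg sum_nonneg)
      have sum: "(\<Sum>i\<in>I. r * exp (y i)) + r = r * S"
        by (simp add: S_def sum_distrib_left distrib_left)
      have G_arg: "(\<lambda>i\<in>I. (\<lambda>i\<in>I. r * exp (y i)) i / (r * S)) = (\<lambda>i\<in>I. exp (y i) / S)"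
        using r by (auto simp: fun_eq_iff)
      have lt: "(\<Sum>i\<in>I. r * exp (y i)) < r * S"
        using sum r by linarith
      have ind: "r * S < 1 \<longleftrightarrow> r < 1 / S" using S by (simp add: field_simps)
      have "ennreal ((1 / (r * S)) ^ card I) * (\<Prod>i\<in>I. ennreal (r * exp (y i)))
          = ennreal ((1 / (r * S)) ^ card I * (\<Prod>i\<in>I. r * exp (y i)))"
        using r S by (subst prod_ennreal) (auto simp: ennreal_mult prod_nonneg)
      also have "(1 / (r * S)) ^ card I * (\<Prod>i\<in>I. r * exp (y i)) = (\<Prod>i\<in>I. exp (y i)) / S ^ card I"
        using r S by (simp add: prod.distrib power_mult_distrib power_one_over field_simps)
      finally have jac: "ennreal ((1 / (r * S)) ^ card I) * (\<Prod>i\<in>I. ennreal (r * exp (y i)))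
          = ennreal ((\<Prod>i\<in>I. exp (y i)) / S ^ card I)" .
      have "K (r * S) (\<lambda>i\<in>I. r * exp (y i)) = G (\<lambda>i\<in>I. exp (y i) / S) *
          indicator {..<1 / S} r * ennreal ((1 / (r * S)) ^ card I)"
        unfolding K_def G_arg using r S lt ind by (simp add: indicator_def)
      then show "K ((\<Sum>i\<in>I. (\<lambda>i\<in>I. r * exp (y i)) i) + r) (\<lambda>i\<in>I. r * exp (y i)) *
            (\<Prod>i\<in>I. ennreal (r * exp (y i)))
          = G (\<lambda>i\<in>I. exp (y i) / (1 + (\<Sum>j\<in>I. exp (y j)))) *
          ennreal ((\<Prod>i\<in>I. exp (y i)) / (1 + (\<Sum>j\<in>I. exp (y j))) ^ card I) *
          indicator {..<1 / (1 + (\<Sum>j\<in>I. exp (y j)))} r"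
        using sum by (simp add: jac[symmetric] mult_ac flip: S_def)
    qed
    finally show ?thesis by (simp add: pos_def)
  qed

  have [measurable]: "(\<lambda>y. \<lambda>i\<in>I. exp (y i) / (1 + (\<Sum>j\<in>I. exp (y j)))) \<in> measurable P P"
    by (rule res) measurable
  define H where "H y = G (\<lambda>i\<in>I. exp (y i) / (1 + (\<Sum>j\<in>I. exp (y j)))) *
      ennreal ((\<Prod>i\<in>I. exp (y i)) / (1 + (\<Sum>j\<in>I. exp (y j))) ^ card I)" for y
  have [measurable]: "H \<in> borel_measurable P"
    unfolding H_def by measurable

  \<comment> \<open>The unit interval has length 1, so the auxiliary variable t can be introduced at
    no cost.\<close>
  have "?L = (\<integral>\<^sup>+t. ?L * indicator {0<..<1::real} t \<partial>lborel)"
    by (simp add: nn_integral_cmult)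
  also have "\<dots> = (\<integral>\<^sup>+t. \<integral>\<^sup>+w. K t w * pos w \<partial>P \<partial>lborel)"
    by (simp add: scaling)
  also have "\<dots> = (\<integral>\<^sup>+w. \<integral>\<^sup>+t. K t w * pos w \<partial>lborel \<partial>P)"
    by (rule LP.Fubini'[symmetric]) measurable
  also have "\<dots> = (\<integral>\<^sup>+w. \<integral>\<^sup>+r. K ((\<Sum>i\<in>I. w i) + r) w * pos w * indicator {0<..} r \<partial>lborel \<partial>P)"
    by (intro nn_integral_cong translation)
  also have "\<dots> = (\<integral>\<^sup>+r. \<integral>\<^sup>+w. K ((\<Sum>i\<in>I. w i) + r) w * pos w * indicator {0<..} r \<partial>P \<partial>lborel)"
    by (rule LP.Fubini') measurable
  also have "\<dots> = (\<integral>\<^sup>+r. \<integral>\<^sup>+y. H y * indicator {0<..<1 / (1 + (\<Sum>j\<in>I. exp (y j)))} r \<partial>P \<partial>lborel)"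
  proof (rule nn_integral_cong)
    fix r :: real
    show "(\<integral>\<^sup>+w. K ((\<Sum>i\<in>I. w i) + r) w * pos w * indicator {0<..} r \<partial>P)
        = (\<integral>\<^sup>+y. H y * indicator {0<..<1 / (1 + (\<Sum>j\<in>I. exp (y j)))} r \<partial>P)"
      \<comment> \<open>The lower bound on r comes from the translation and the upper one from t <
        1; together they give an interval of length 1/S.\<close>
      using exponential[of r] by (cases "0 < r") (simp_all add: H_def indicator_def)
  qed
  also have "\<dots> = (\<integral>\<^sup>+y. \<integral>\<^sup>+r. H y * indicator {0<..<1 / (1 + (\<Sum>j\<in>I. exp (y j)))} r \<partial>lborel \<partial>P)"
    by (rule LP.Fubini'[symmetric]) (measurable, simp only: greaterThanLessThan_iff, measurable)
  also have "\<dots> = ?R"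
  proof (rule nn_integral_cong)
    fix y :: "'i \<Rightarrow> real"
    have S: "1 + (\<Sum>j\<in>I. exp (y j)) > 0" (is "?S > 0")
      by (simp add: add_pos_nonneg sum_nonneg)
    have "0 \<le> (\<Prod>i\<in>I. exp (y i)) / ?S ^ card I"
      using S by (intro divide_nonneg_pos prod_nonneg zero_less_power) auto
    then have jac: "ennreal ((\<Prod>i\<in>I. exp (y i)) / ?S ^ card I) * ennreal (1 / ?S)
        = ennreal ((\<Prod>i\<in>I. exp (y i)) / ?S ^ Suc (card I))"
      by (subst ennreal_mult'[symmetric]) (simp_all add: mult.commute)
    have "(\<integral>\<^sup>+r. H y * indicator {0<..<1 / ?S} r \<partial>lborel) = H y * ennreal (1 / ?S)"
      using S by (simp add: nn_integral_cmult)
    then show "(\<integral>\<^sup>+r. H y * indicator {0<..<1 / ?S} r \<partial>lborel)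
        = G (\<lambda>i\<in>I. exp (y i) / ?S) * ennreal ((\<Prod>i\<in>I. exp (y i)) / ?S ^ Suc (card I))"
      by (simp only: H_def mult.assoc jac)
  qed
  finally show ?thesis .
qed

section \<open>The density of the log-ratio vector\<close>

theorem mainTheorem2:
  fixes M :: "'a measure" and n :: nat and \<alpha> :: "nat \<Rightarrow> real" and X :: "nat \<Rightarrow> 'a \<Rightarrow> real"
  assumes "prob_space M"
    and "n \<ge> 2"
    and "\<And>i. i \<in> {1..n} \<Longrightarrow> \<alpha> i > 0"
    and "dirichlet_distributed M n \<alpha> X"
  shows "distributed M (lborel_prod n)
    (\<lambda>\<omega>. \<lambda>i\<in>{1..<n}. ln (X i \<omega> / X n \<omega>))
    (\<lambda>y. ennreal (1 / multi_beta n \<alpha> * (\<Prod>i\<in>{1..<n}. exp (y i) powr \<alpha> i) *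
      (1 + (\<Sum>i\<in>{1..<n}. exp (y i))) powr (- (\<Sum>i=1..n. \<alpha> i))))"
proof -
  define I where "I = {1..<n}"
  define P where "P = lborel_prod n"
  define p where "p = dirichlet_density n \<alpha>"
  \<comment> \<open>\<open>L\<close> is the log-ratio map written in the first n - 1 components
    alone, the last one being 1 minus their sum. \<open>T\<close> inverts it on the open
    simplex.\<close>
  define L where "L x = (\<lambda>i\<in>I. ln (x i / (1 - (\<Sum>j\<in>I. x j))))" for x :: "nat \<Rightarrow> real"
  define T where "T y = (\<lambda>i\<in>I. exp (y i) / (1 + (\<Sum>j\<in>I. exp (y j))))" for y :: "nat \<Rightarrow> real"
  define f where "f y = 1 / multi_beta n \<alpha> * (\<Prod>i\<in>I. exp (y i) powr \<alpha> i) *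
      (1 + (\<Sum>i\<in>I. exp (y i))) powr (- (\<Sum>i=1..n. \<alpha> i))" for y :: "nat \<Rightarrow> real"
  have I: "{1..n} = insert n I" "n \<notin> I" "finite I" "Suc (card I) = n"
    using \<open>n \<ge> 2\<close> by (auto simp: I_def)
  have X [measurable]: "X i \<in> borel_measurable M" if "i \<in> insert n I" for i
    using assms(4) that unfolding dirichlet_distributed_def I by blast
  have X_AE: "AE \<omega> in M. (\<Sum>i\<in>insert n I. X i \<omega>) = 1"
    using assms(4) unfolding dirichlet_distributed_def I by auto
  have X_distr: "distributed M P (\<lambda>\<omega>. \<lambda>i\<in>I. X i \<omega>) (\<lambda>x. ennreal (p x))"
    using assms(4) unfolding dirichlet_distributed_def I_def P_def p_def by blast
  note X_density = distributed_distr_eq_density[OF X_distr]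
  have [measurable]: "(\<lambda>x. ennreal (p x)) \<in> borel_measurable P"
      "(\<lambda>\<omega>. \<lambda>i\<in>I. X i \<omega>) \<in> measurable M P"
    using X_distr unfolding distributed_def by blast+
  have [measurable]: "i \<in> I \<Longrightarrow> (\<lambda>w. w i) \<in> borel_measurable P" for i
    unfolding P_def I_def by simp
  have res: "(\<lambda>z. \<lambda>i\<in>I. g z i) \<in> measurable N P"
    if "\<And>i. i \<in> I \<Longrightarrow> (\<lambda>z. g z i) \<in> borel_measurable N" for g and N :: "'z measure"
    unfolding P_def I_def[symmetric] using that by (intro measurable_restrict) simp
  have [measurable]: "L \<in> measurable P P"
    unfolding L_def by (rule res) measurable
  have [measurable]: "(\<lambda>\<omega>. \<lambda>i\<in>I. ln (X i \<omega> / X n \<omega>)) \<in> measurable M P"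
    by (rule res) measurable
  have [measurable]: "(\<lambda>y. ennreal (f y)) \<in> borel_measurable P"
    unfolding f_def by measurable

  \<comment> \<open>With S = 1 + sum exp(y), the last component belonging to \<open>T y\<close> is
    1/S, so the ratios return exp(y). Membership in \<open>space P\<close> makes \<open>y\<close>
    extensional, which gives equality off \<open>I\<close> too.\<close>
  have L_T: "L (T y) = y" if "y \<in> space P" for y
  proof -
    define S where "S = 1 + (\<Sum>j\<in>I. exp (y j))"
    have S: "S > 0" unfolding S_def by (simp add: add_pos_nonneg sum_nonneg)
    have "(\<Sum>j\<in>I. T y j) = (S - 1) / S"
      by (simp add: T_def S_def sum_divide_distrib)
    then have "1 - (\<Sum>j\<in>I. T y j) = 1 / S" using S by (simp add: field_simps)
    then have "L (T y) i = y i" if "i \<in> I" for i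
      using S that by (simp add: L_def T_def flip: S_def)
    with that show ?thesis
      by (auto simp: fun_eq_iff L_def P_def I_def space_PiM PiE_def extensional_def)
  qed

  \<comment> \<open>All n components of the simplex point, the last being 1/S, carry a denominator
    S. Their powers combine to S^n times S to the minus sum of the \<open>\<alpha> i\<close>, and
    the Jacobian cancels S^n. Its numerator raises each exponent \<open>\<alpha> i - 1\<close> of
    exp(y_i) to \<open>\<alpha> i\<close>.\<close>
  have p_T: "p (T y) * ((\<Prod>i\<in>I. exp (y i)) / (1 + (\<Sum>j\<in>I. exp (y j))) ^ n) = f y" for y
  proof -
    define S where "S = 1 + (\<Sum>j\<in>I. exp (y j))"
    have S: "S > 0" unfolding S_def by (simp add: add_pos_nonneg sum_nonneg)
    have sum: "(\<Sum>j\<in>I. T y j) = (S - 1) / S"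
      by (simp add: T_def S_def sum_divide_distrib)
    then have rest: "1 - (\<Sum>j\<in>I. T y j) = 1 / S" using S by (simp add: field_simps)
    have lt: "(\<Sum>j\<in>I. T y j) < 1" using rest S by (simp add: sum)
    have T_pos: "\<forall>i\<in>I. 0 < T y i" using S by (simp add: T_def flip: S_def)
    have "(\<Prod>i\<in>insert n I. ((T y)(n := 1 / S)) i powr (\<alpha> i - 1))
        = (1 / S) powr (\<alpha> n - 1) * (\<Prod>i\<in>I. (exp (y i) / S) powr (\<alpha> i - 1))"
      using I(2,3) by (auto simp: T_def S_def intro!: prod.cong)
    also have "\<dots> = (\<Prod>i\<in>I. exp (y i) powr \<alpha> i / exp (y i)) * (\<Prod>i\<in>insert n I. S powr (1 - \<alpha> i))"
      using I(2,3) S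
      by (simp add: powr_divide powr_diff prod_dividef prod.distrib mult_ac)
    also have "(\<Prod>i\<in>insert n I. S powr (1 - \<alpha> i)) = S powr (\<Sum>i\<in>insert n I. 1 - \<alpha> i)"
      using I(3) S by (subst powr_sum) auto
    also have "\<dots> = S ^ n * S powr (- (\<Sum>i=1..n. \<alpha> i))"
      using I S by (simp add: sum_subtractf powr_add powr_diff powr_minus field_simps flip: powr_realpow)
    finally have "(\<Prod>i\<in>insert n I. ((T y)(n := 1 / S)) i powr (\<alpha> i - 1))
        = (\<Prod>i\<in>I. exp (y i) powr \<alpha> i) / (\<Prod>i\<in>I. exp (y i)) * (S ^ n * S powr (- (\<Sum>i=1..n. \<alpha> i)))"
      by (simp add: prod_dividef)
    moreover have "(\<Prod>i\<in>I. exp (y i)) \<noteq> 0" using I(3) by simp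
    ultimately show ?thesis
      using S lt T_pos rest
      unfolding p_def dirichlet_density_def f_def I_def[symmetric] S_def[symmetric]
      by (simp add: I(1)[simplified] del: prod.insert sum.insert)
  qed

  \<comment> \<open>The components sum to 1 only almost surely, so the two vectors are compared
    through their laws.\<close>
  have "distr M P (\<lambda>\<omega>. \<lambda>i\<in>I. ln (X i \<omega> / X n \<omega>)) = distr M P (\<lambda>\<omega>. L (\<lambda>i\<in>I. X i \<omega>))"
  proof (rule distr_cong_AE)
    show "AE \<omega> in M. (\<lambda>i\<in>I. ln (X i \<omega> / X n \<omega>)) = L (\<lambda>i\<in>I. X i \<omega>)"
      using X_AE
    proof eventually_elim
      case (elim \<omega>)
      then have "X n \<omega> = 1 - (\<Sum>j\<in>I. X j \<omega>)" using I by simp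
      then show ?case by (auto simp: L_def fun_eq_iff)
    qed
  qed simp_all
  also have "\<dots> = distr (density P (\<lambda>x. ennreal (p x))) P L"
    by (simp add: X_density[symmetric] distr_distr comp_def)
  also have "\<dots> = density P (\<lambda>y. ennreal (f y))"
  proof (rule measure_eqI)
    fix A assume "A \<in> sets (distr (density P (\<lambda>x. ennreal (p x))) P L)"
    then have [measurable]: "A \<in> sets P" by simp
    define G where "G x = ennreal (p x) * indicator A (L x)" for x
    have [measurable]: "G \<in> borel_measurable P" unfolding G_def by measurable
    have "emeasure (distr (density P (\<lambda>x. ennreal (p x))) P L) A
        = (\<integral>\<^sup>+x. indicator A x \<partial>distr (density P (\<lambda>x. ennreal (p x))) P L)"
      by simp
    also have "\<dots> = (\<integral>\<^sup>+x. G x \<partial>P)"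
      by (simp add: nn_integral_distr nn_integral_density G_def del: nn_integral_indicator)
    \<comment> \<open>The density is 0 off the open simplex, so its indicators can be inserted to
      match the substitution lemma.\<close>
    also have "\<dots> = (\<integral>\<^sup>+x. G x * indicator {..<1} (\<Sum>i\<in>I. x i) * (\<Prod>i\<in>I. indicator {0<..} (x i)) \<partial>P)"
    proof (rule nn_integral_cong)
      fix x
      have "p x = 0" if "\<not> ((\<Sum>i\<in>I. x i) < 1 \<and> (\<forall>i\<in>I. 0 < x i))"
        using that by (auto simp: p_def dirichlet_density_def I_def)
      then show "G x = G x * indicator {..<1} (\<Sum>i\<in>I. x i) * (\<Prod>i\<in>I. indicator {0<..} (x i))"
        by (cases "(\<Sum>i\<in>I. x i) < 1 \<and> (\<forall>i\<in>I. 0 < x i)") (auto simp: G_def)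
    qed
    also have "\<dots> = (\<integral>\<^sup>+y. G (T y) * ennreal ((\<Prod>i\<in>I. exp (y i)) / (1 + (\<Sum>j\<in>I. exp (y j))) ^ n) \<partial>P)"
      using nn_integral_log_ratio_substitution[OF I(3), of G] \<open>G \<in> borel_measurable P\<close>
      unfolding P_def I_def[symmetric] T_def I(4) by simp
    also have "\<dots> = (\<integral>\<^sup>+y. ennreal (f y) * indicator A y \<partial>P)"
    proof (rule nn_integral_cong)
      fix y assume y: "y \<in> space P"
      have "0 \<le> (\<Prod>i\<in>I. exp (y i)) / (1 + (\<Sum>j\<in>I. exp (y j))) ^ n"
        by (intro divide_nonneg_nonneg prod_nonneg zero_le_power add_nonneg_nonneg sum_nonneg) auto
      then show "G (T y) * ennreal ((\<Prod>i\<in>I. exp (y i)) / (1 + (\<Sum>j\<in>I. exp (y j))) ^ n)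
          = ennreal (f y) * indicator A y"
        \<comment> \<open>\<open>L_T\<close> turns the event L(T y) in A into y in A, and
          \<open>p_T\<close> absorbs the Jacobian into \<open>f\<close>.\<close>
        using L_T[OF y] by (simp add: G_def p_T[symmetric] ennreal_mult'' mult_ac del: times_divide_eq_right)
    qed
    also have "\<dots> = emeasure (density P (\<lambda>y. ennreal (f y))) A"
      by (simp add: emeasure_density)
    finally show "emeasure (distr (density P (\<lambda>x. ennreal (p x))) P L) A
        = emeasure (density P (\<lambda>y. ennreal (f y))) A" .
  qed simp
  finally have "distributed M P (\<lambda>\<omega>. \<lambda>i\<in>I. ln (X i \<omega> / X n \<omega>)) (\<lambda>y. ennreal (f y))"
    unfolding distributed_def by simp
  then show ?thesis unfolding P_def I_def f_def .
qed

end
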